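(* Let $\|\cdot\|$ be any norm on $\mathbb{R}^2$. Let $N(u):=\|(u,1)\|$ for all real $u$. Then the function $N$ is convex, the limit $$c:=\lim_{u\to\infty}\big(\|(u,1)\|-2\|(u,0)\|+\|(u,-1)\|\big)$$ exists and is finite and nonnegative, and $$\|(u,v)\|=\frac{c|v|}{2}+\frac12\int_{\mathbb{R}}|u-tv|\,\mathrm{d}N'(t)\quad\text{for all }(u,v)\in\mathbb{R}^2.$$
   Context: For a convex function $f\colon\mathbb{R}\to\mathbb{R}$, let $f'_+$ and $f'_-$ denote its right and left derivatives (finite, nondecreasing, and respectively right- and left-continuous), and let $f':=(f'_++f'_-)/2$, which is nondecreasing. The Lebesgue--Stieltjes integral $\int_{\mathbb{R}}\varphi(t)\,\mathrm{d}f'(t)$ is the Lebesgue integral $\int_{\mathbb{R}}\varphi\,\mathrm{d}\nu$, where $\nu$ is the Borel measure on $\mathbb{R}$ determined by the condition $\nu\big((a,b]\big)=f'_+(b)-f'_+(a)$ for all real $a<b$. In the claim this is applied with $f=N$. *)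

theory Defs
  imports "HOL-Analysis.Analysis"
begin

text \<open>The type class \<^class>\<open>real_normed_vector\<close> fixes one norm per type; this predicate allows
  for an arbitrary norm on a given real vector space.\<close>

definition is_norm :: "('a::real_vector \<Rightarrow> real) \<Rightarrow> bool" where
  "is_norm p \<longleftrightarrow>
     (\<forall>x. p x \<ge> 0) \<and>
     (\<forall>x. p x = 0 \<longleftrightarrow> x = 0) \<and>
     (\<forall>a x. p (a *\<^sub>R x) = \<bar>a\<bar> * p x) \<and>
     (\<forall>x y. p (x + y) \<le> p x + p y)"

definition right_deriv :: "(real \<Rightarrow> real) \<Rightarrow> real \<Rightarrow> real" where
  "right_deriv f x = Lim (at_right x) (\<lambda>y. (f y - f x) / (y - x))"

text \<open>For convex \<open>f\<close>, the measure \<open>df'\<close> is the Borel measure that gives \<open>{a<..b}\<close> the mass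
  \<open>f'\<^sub>+(b) - f'\<^sub>+(a)\<close>; the value that \<open>f'\<close> takes at its jumps, \<open>(f'\<^sub>+ + f'\<^sub>-) / 2\<close>,
  does not enter. For other \<open>f\<close> the definition is meaningless; for convex \<open>f\<close>, the lemma
  \<open>emeasure_deriv_measure_Ioc\<close> below shows that it is the intended measure.\<close>

definition deriv_measure :: "(real \<Rightarrow> real) \<Rightarrow> real measure" where
  "deriv_measure f = interval_measure (right_deriv f)"

lemma sets_deriv_measure: "sets (deriv_measure f) = sets borel"
  by (simp add: deriv_measure_def)

context
  fixes f :: "real \<Rightarrow> real"
  assumes cvx: "convex_on UNIV f"
begin

lemma convex_slope_mono:
  fixes x y z :: real
  assumes "x < y" "y < z"
  shows "(f y - f x) / (y - x) \<le> (f z - f x) / (z - x)"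
    and "(f z - f x) / (z - x) \<le> (f z - f y) / (z - y)"
proof -
  define t where "t = (y - x) / (z - x)"
  have t: "0 \<le> t" "t \<le> 1" and "t * (z - x) = y - x"
    using assms by (auto simp: t_def)
  then have y: "y = (1 - t) *\<^sub>R x + t *\<^sub>R z"
    by (simp add: algebra_simps)
  have "f y \<le> (1 - t) * f x + t * f z"
    unfolding y using convex_onD[OF cvx t, of x z] by simp
  then have "f y - f x \<le> t * (f z - f x)"
    by (simp add: algebra_simps)
  then have "(f y - f x) * (z - x) \<le> (t * (f z - f x)) * (z - x)"
    using assms by (intro mult_right_mono) auto
  also have "\<dots> = (y - x) * (f z - f x)"
    using \<open>t * (z - x) = y - x\<close> by (metis mult.assoc mult.commute)
  finally have *: "(f y - f x) * (z - x) \<le> (y - x) * (f z - f x)" .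
  then show "(f y - f x) / (y - x) \<le> (f z - f x) / (z - x)"
    using assms by (simp add: divide_le_eq le_divide_eq mult.commute)
  have "(f z - f x) * (z - y) \<le> (f z - f y) * (z - x)"
    using * by (simp add: algebra_simps)
  then show "(f z - f x) / (z - x) \<le> (f z - f y) / (z - y)"
    using assms by (simp add: frac_le_eq divide_le_0_iff)
qed

lemma right_deriv_tendsto:
  "((\<lambda>y. (f y - f x) / (y - x)) \<longlongrightarrow> right_deriv f x) (at_right x)"
  and right_deriv_le_slope: "x < y \<Longrightarrow> right_deriv f x \<le> (f y - f x) / (y - x)"
  and slope_le_right_deriv: "y < x \<Longrightarrow> (f x - f y) / (x - y) \<le> right_deriv f x"
proof -
  let ?q = "\<lambda>y. (f y - f x) / (y - x)"
  let ?L = "Inf (?q ` {x<..})"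
  have lb: "(f x - f w) / (x - w) \<le> ?q y" if "w < x" "x < y" for w y
    using convex_slope_mono[OF that] by linarith
  have bdd: "bdd_below (?q ` {x<..})"
    by (rule bdd_belowI2[of _ "(f x - f (x - 1)) / (x - (x - 1))"]) (rule lb, auto)
  have le: "?L \<le> ?q y" if "x < y" for y
    using that by (intro cInf_lower bdd) auto
  have lim: "(?q \<longlongrightarrow> ?L) (at_right x)"
  proof (rule decreasing_tendsto)
    show "\<forall>\<^sub>F y in at_right x. ?L \<le> ?q y"
      using le by (auto simp: eventually_at_filter intro!: always_eventually)
    fix l assume "?L < l"
    then obtain z where z: "z > x" "?q z < l"
      using cInf_less_iff[OF _ bdd] by auto
    have "?q y < l" if "x < y" "y < z" for y
      using convex_slope_mono(1)[OF that] z by linarith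
    then show "\<forall>\<^sub>F y in at_right x. ?q y < l"
      using z eventually_at_right by blast
  qed
  then have eq: "right_deriv f x = ?L"
    unfolding right_deriv_def by (intro tendsto_Lim) auto
  show "(?q \<longlongrightarrow> right_deriv f x) (at_right x)"
    using lim eq by simp
  show "x < y \<Longrightarrow> right_deriv f x \<le> (f y - f x) / (y - x)"
    using le eq by simp
  show "y < x \<Longrightarrow> (f x - f y) / (x - y) \<le> right_deriv f x"
    unfolding eq by (rule cInf_greatest) (use lb in auto)
qed

lemma right_deriv_mono: "x \<le> y \<Longrightarrow> right_deriv f x \<le> right_deriv f y"
  using right_deriv_le_slope[of x y] slope_le_right_deriv[of x y]
  by (cases "x = y") auto

lemma right_deriv_right_continuous: "continuous (at_right x) (right_deriv f)"
  unfolding continuous_within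
proof (rule decreasing_tendsto)
  show "\<forall>\<^sub>F y in at_right x. right_deriv f x \<le> right_deriv f y"
    using right_deriv_mono by (auto simp: eventually_at_filter intro!: always_eventually)
  fix l assume "right_deriv f x < l"
  then have "\<forall>\<^sub>F y in at_right x. (f y - f x) / (y - x) < l"
    using right_deriv_tendsto order_tendstoD(2) by blast
  then obtain b where b: "x < b" "\<And>y. x < y \<Longrightarrow> y < b \<Longrightarrow> (f y - f x) / (y - x) < l"
    unfolding eventually_at_right[OF less_add_one] by auto
  obtain z where z: "x < z" "z < b" using b(1) dense by blast
  have "continuous_on UNIV f"
    using convex_on_continuous[OF _ cvx] by simp
  then have "(f \<longlongrightarrow> f x) (at_right x)"
    by (simp add: continuous_on_def filterlim_at_split)
  then have "((\<lambda>y. (f z - f y) / (z - y)) \<longlongrightarrow> (f z - f x) / (z - x)) (at_right x)"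
    using z by (intro tendsto_intros) auto
  then have "\<forall>\<^sub>F y in at_right x. (f z - f y) / (z - y) < l"
    using b(2)[OF z] order_tendstoD(2) by blast
  moreover have "\<forall>\<^sub>F y in at_right x. y < z"
    using z eventually_at_right by blast
  ultimately show "\<forall>\<^sub>F y in at_right x. right_deriv f y < l"
    by eventually_elim (use right_deriv_le_slope in fastforce)
qed

lemma emeasure_deriv_measure_Ioc:
  "a \<le> b \<Longrightarrow> emeasure (deriv_measure f) {a<..b} = ennreal (right_deriv f b - right_deriv f a)"
  unfolding deriv_measure_def
  by (intro emeasure_interval_measure_Ioc right_deriv_mono right_deriv_right_continuous)

end

end

theory Submission
  imports Defs
begin

text \<open>
  Write \<open>A\<close> for the norm of \<open>(1, 0)\<close>, \<open>D\<close> for the right derivative of \<open>N\<close> and \<open>\<mu>\<close> for the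
  measure \<open>dN'\<close>. By homogeneity the formula for \<open>v \<noteq> 0\<close> reduces to \<open>v = 1\<close>, that is, to
  \<open>2 N(x) = c + \<integral> \<bar>x - t\<bar> d\<mu>(t)\<close>. The triangle inequality bounds \<open>N(u)\<close> above and below by
  \<open>A\<bar>u\<bar>\<close> up to the constant \<open>N(0)\<close>, so \<open>D\<close> increases from \<open>-A\<close> to \<open>A\<close>; hence \<open>\<mu>\<close> has total
  mass \<open>2A\<close>, which is the formula for \<open>v = 0\<close>.

  For \<open>v = 1\<close> the idea is that both sides have the same second derivative, \<open>2 dN'\<close>, and that
  the boundary values at \<open>\<plusminus>\<infinity>\<close> fix the remaining affine term. To keep all integrals finite, replace
  \<open>t\<close> by its truncation to \<open>[-r, r]\<close> and call the resulting integral \<open>\<Phi>\<^sub>r(x)\<close>.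
  Over \<open>x \<le> y\<close> in \<open>[-r, r]\<close>, the increments of \<open>\<Phi>\<^sub>r\<close> and of \<open>2N\<close> both
  lie between \<open>2 D(x) (y - x)\<close> and \<open>2 D(y) (y - x)\<close>. The difference \<open>\<Phi>\<^sub>r - 2N\<close> then has increments
  at most \<open>2 (D(y) - D(x)) (y - x)\<close>, and subdividing the interval forces it to be constant
  (lemma \<open>const_if_increment_le_product\<close>).
  Since \<open>\<bar>r - s\<bar> + \<bar>-r - s\<bar> = 2r\<close> for \<open>s\<close> in \<open>[-r, r]\<close>, the values at the two end points add up to
  \<open>\<Phi>\<^sub>r(r) + \<Phi>\<^sub>r(-r) = 4Ar\<close>, and this fixes the constant:
  \<open>\<Phi>\<^sub>r(x) = 2N(x) - (N(r) - 2Ar + N(-r))\<close>. Monotone convergence as \<open>r \<rightarrow> \<infinity>\<close> gives the claim, the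
  bracket tending to \<open>c\<close>.
\<close>

section \<open>Functions with second-order bounds on their increments\<close>

text \<open>If \<open>D\<close> is the derivative of two functions in the weak sense that their increments over \<open>[s, t]\<close>
  lie between \<open>(t - s) D(s)\<close> and \<open>(t - s) D(t)\<close>, then their difference \<open>g\<close> satisfies the hypothesis;
  thus the lemma is a fundamental theorem of calculus for monotone, possibly discontinuous \<open>D\<close>.
  Halving the interval halves the lengths while the increments of \<open>D\<close> add up, so the bound
  improves by the factor 2 with each bisection.\<close>

lemma const_if_increment_le_product:
  fixes g D :: "real \<Rightarrow> real"
  assumes incr: "\<And>s t. a \<le> s \<Longrightarrow> s \<le> t \<Longrightarrow> t \<le> b \<Longrightarrow> \<bar>g t - g s\<bar> \<le> (t - s) * (D t - D s)"
    and "a \<le> b"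
  shows "g a = g b"
proof -
  have bisect: "\<bar>g t - g s\<bar> \<le> (t - s) * (D t - D s) / 2 ^ k"
    if "a \<le> s" "s \<le> t" "t \<le> b" for s t k
    using that
  proof (induction k arbitrary: s t)
    case 0
    then show ?case using incr by simp
  next
    case (Suc k)
    define m where "m = (s + t) / 2"
    have m: "s \<le> m" "m \<le> t" "m - s = (t - s) / 2" "t - m = (t - s) / 2"
      using Suc.prems by (auto simp: m_def field_simps)
    have "\<bar>g t - g s\<bar> \<le> \<bar>g m - g s\<bar> + \<bar>g t - g m\<bar>"
      by linarith
    also have "\<dots> \<le> (m - s) * (D m - D s) / 2 ^ k + (t - m) * (D t - D m) / 2 ^ k"
      using Suc.prems m by (intro add_mono Suc.IH) auto
    also have "\<dots> = (t - s) * (D t - D s) / 2 ^ Suc k"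
      unfolding m(3,4) by (simp add: field_simps)
    finally show ?case .
  qed
  have "(\<lambda>k. (b - a) * (D b - D a) / 2 ^ k) \<longlonglongrightarrow> 0"
    by (rule LIMSEQ_divide_realpow_zero) simp
  then have "\<bar>g b - g a\<bar> \<le> 0"
    by (rule LIMSEQ_le_const) (use bisect assms(2) in auto)
  then show ?thesis by simp
qed

section \<open>Convex functions with asymptotic slopes \<open>-A\<close> and \<open>A\<close>\<close>

context
  fixes f :: "real \<Rightarrow> real" and A :: real
  assumes cvx: "convex_on UNIV f"
    and slope_top: "(right_deriv f \<longlongrightarrow> A) at_top"
    and slope_bot: "(right_deriv f \<longlongrightarrow> - A) at_bot"
begin

lemma right_deriv_le_slope_top: "right_deriv f x \<le> A"
  by (rule tendsto_lowerbound[OF slope_top])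
    (auto intro!: eventually_mono[OF eventually_ge_at_top[of x]] right_deriv_mono[OF cvx])

lemma right_deriv_ge_slope_bot: "- A \<le> right_deriv f x"
  by (rule tendsto_upperbound[OF slope_bot])
    (auto intro!: eventually_mono[OF eventually_le_at_bot[of x]] right_deriv_mono[OF cvx])

lemma emeasure_deriv_measure_atMost:
  "emeasure (deriv_measure f) {..x} = ennreal (right_deriv f x + A)"
proof -
  have "(\<lambda>n. emeasure (deriv_measure f) {x - real n<..x}) \<longlonglongrightarrow>
      emeasure (deriv_measure f) (\<Union>n. {x - real n<..x})"
    by (rule Lim_emeasure_incseq) (auto simp: sets_deriv_measure incseq_def)
  moreover have "(\<Union>n. {x - real n<..x}) = {..x}"
  proof safe
    fix t assume "t \<le> x"
    moreover obtain n where "x - t < real n" using reals_Archimedean2 by blast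
    ultimately show "t \<in> (\<Union>n. {x - real n<..x})" by (auto intro!: exI[of _ n])
  qed auto
  moreover have "filterlim (\<lambda>n. x - real n) at_bot sequentially"
    using filterlim_tendsto_add_at_top[OF tendsto_const filterlim_real_sequentially, of "- x"]
    by (simp add: filterlim_uminus_at_bot)
  then have "(\<lambda>n. right_deriv f x - right_deriv f (x - real n)) \<longlonglongrightarrow> right_deriv f x - (- A)"
    by (intro tendsto_intros filterlim_compose[OF slope_bot])
  then have "(\<lambda>n. emeasure (deriv_measure f) {x - real n<..x}) \<longlonglongrightarrow> ennreal (right_deriv f x + A)"
    by (simp add: emeasure_deriv_measure_Ioc[OF cvx] tendsto_ennrealI)
  ultimately show ?thesis
    by (simp add: LIMSEQ_unique)
qed

lemma emeasure_deriv_measure_UNIV: "emeasure (deriv_measure f) UNIV = ennreal (2 * A)"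
proof -
  have "(\<lambda>n. emeasure (deriv_measure f) {..real n}) \<longlonglongrightarrow>
      emeasure (deriv_measure f) (\<Union>n. {..real n})"
    by (rule Lim_emeasure_incseq) (auto simp: sets_deriv_measure incseq_def)
  moreover have "(\<Union>n. {..real n}) = UNIV"
    using real_arch_simple by auto
  moreover have "(\<lambda>n. right_deriv f (real n) + A) \<longlonglongrightarrow> A + A"
    by (intro tendsto_intros filterlim_compose[OF slope_top] filterlim_real_sequentially)
  then have "(\<lambda>n. emeasure (deriv_measure f) {..real n}) \<longlonglongrightarrow> ennreal (2 * A)"
    by (simp add: emeasure_deriv_measure_atMost tendsto_ennrealI)
  ultimately show ?thesis
    by (simp add: LIMSEQ_unique)
qed

lemma space_deriv_measure: "space (deriv_measure f) = UNIV"
  by (simp add: deriv_measure_def)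

lemma finite_measure_deriv_measure: "finite_measure (deriv_measure f)"
  by (rule finite_measureI) (simp add: emeasure_deriv_measure_UNIV space_deriv_measure)

lemma measure_deriv_measure_UNIV: "measure (deriv_measure f) UNIV = 2 * A"
  using right_deriv_le_slope_top[of 0] right_deriv_ge_slope_bot[of 0]
  by (simp add: measure_def emeasure_deriv_measure_UNIV)

lemma measure_deriv_measure_atMost: "measure (deriv_measure f) {..x} = right_deriv f x + A"
  using right_deriv_ge_slope_bot[of x]
  by (simp add: measure_def emeasure_deriv_measure_atMost)

text \<open>Up to the factor \<open>d\<close>, the integrand is the right derivative of \<open>\<bar>x - t\<bar>\<close> with respect to \<open>x\<close>.
  Its integral \<open>2 D(x)\<close> is thus the slope that \<open>\<integral> \<bar>x - t\<bar> d\<mu>(t)\<close> must have.\<close>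

lemma has_bochner_integral_sign:
  "has_bochner_integral (deriv_measure f) (\<lambda>t. d * (2 * indicator {..x} t - 1))
     (d * (2 * right_deriv f x))"
proof -
  interpret finite_measure "deriv_measure f" by (rule finite_measure_deriv_measure)
  have *: "has_bochner_integral (deriv_measure f) (indicator {..x}) (right_deriv f x + A)"
    using has_bochner_integral_real_indicator[of "{..x}" "deriv_measure f"]
    by (simp add: sets_deriv_measure measure_deriv_measure_atMost emeasure_eq_measure)
  have "has_bochner_integral (deriv_measure f) (indicator UNIV) (2 * A)"
    using has_bochner_integral_real_indicator[of "UNIV" "deriv_measure f"]
    by (simp add: sets_deriv_measure measure_deriv_measure_UNIV emeasure_eq_measure)
  then have "has_bochner_integral (deriv_measure f) (\<lambda>t. d * (2 * indicator {..x} t - indicator UNIV t))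
     (d * (2 * (right_deriv f x + A) - 2 * A))"
    by (intro has_bochner_integral_mult_right has_bochner_integral_diff *)
  then show ?thesis by simp
qed

lemma integrable_truncated_abs:
  "integrable (deriv_measure f) (\<lambda>t. \<bar>x - max (- r) (min r t)\<bar>)"
proof -
  interpret finite_measure "deriv_measure f" by (rule finite_measure_deriv_measure)
  show ?thesis
    by (rule integrable_const_bound[of _ "\<bar>x\<bar> + \<bar>r\<bar>"])
      (auto simp: measurable_cong_sets[OF sets_deriv_measure refl])
qed

lemma integral_truncated_abs:
  assumes "\<bar>x\<bar> \<le> r"
  shows "(\<integral>t. \<bar>x - max (- r) (min r t)\<bar> \<partial>deriv_measure f) = 2 * f x - (f r - 2 * A * r + f (- r))"
proof -
  define \<Phi> where "\<Phi> y = (\<integral>t. \<bar>y - max (- r) (min r t)\<bar> \<partial>deriv_measure f)" for y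
  have \<Phi>: "2 * right_deriv f s * (t - s) \<le> \<Phi> t - \<Phi> s"
    "\<Phi> t - \<Phi> s \<le> 2 * right_deriv f t * (t - s)"
    if "- r \<le> s" "s \<le> t" "t \<le> r" for s t
  proof -
    have \<Phi>_diff: "\<Phi> t - \<Phi> s = (\<integral>z. \<bar>t - max (- r) (min r z)\<bar> - \<bar>s - max (- r) (min r z)\<bar> \<partial>deriv_measure f)"
      unfolding \<Phi>_def by (simp add: integrable_truncated_abs)
    \<comment> \<open>As the first argument moves from \<open>s\<close> to \<open>t\<close>, the integrand grows by \<open>t - s\<close> for \<open>z \<le> s\<close>, falls by
      \<open>t - s\<close> for \<open>z \<ge> t\<close>, and changes by something in between otherwise. The truncation leaves this
      intact, because \<open>s\<close> and \<open>t\<close> lie in the truncation interval.\<close>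
    have "(\<integral>z. (t - s) * (2 * indicator {..s} z - 1) \<partial>deriv_measure f) \<le> \<Phi> t - \<Phi> s"
      unfolding \<Phi>_diff using that
      by (intro integral_mono Bochner_Integration.integrable_diff integrable_truncated_abs
          integrable.intros[OF has_bochner_integral_sign])
        (auto simp: indicator_def)
    then show "2 * right_deriv f s * (t - s) \<le> \<Phi> t - \<Phi> s"
      unfolding has_bochner_integral_integral_eq[OF has_bochner_integral_sign] by (simp add: mult_ac)
    have "\<Phi> t - \<Phi> s \<le> (\<integral>z. (t - s) * (2 * indicator {..t} z - 1) \<partial>deriv_measure f)"
      unfolding \<Phi>_diff using that
      by (intro integral_mono Bochner_Integration.integrable_diff integrable_truncated_abs
          integrable.intros[OF has_bochner_integral_sign])
        (auto simp: indicator_def)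
    then show "\<Phi> t - \<Phi> s \<le> 2 * right_deriv f t * (t - s)"
      unfolding has_bochner_integral_integral_eq[OF has_bochner_integral_sign] by (simp add: mult_ac)
  qed
  have f: "right_deriv f s * (t - s) \<le> f t - f s" "f t - f s \<le> right_deriv f t * (t - s)"
    if "s \<le> t" for s t
    using that right_deriv_le_slope[OF cvx, of s t] slope_le_right_deriv[OF cvx, of s t]
    by (cases "s = t"; simp add: field_simps)+
  have const: "\<Phi> s - 2 * f s = \<Phi> t - 2 * f t" if st: "- r \<le> s" "s \<le> t" "t \<le> r" for s t
  proof (rule const_if_increment_le_product[where g = "\<lambda>x. \<Phi> x - 2 * f x"
        and a = s and b = t and D = "\<lambda>x. 2 * right_deriv f x"])
    fix p q assume "s \<le> p" "p \<le> q" "q \<le> t"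
    then have "- r \<le> p" "p \<le> q" "q \<le> r"
      using st by auto
    then show "\<bar>(\<Phi> q - 2 * f q) - (\<Phi> p - 2 * f p)\<bar> \<le> (q - p) * (2 * right_deriv f q - 2 * right_deriv f p)"
      using \<Phi>[of p q] f[of p q] by (simp add: abs_le_iff algebra_simps)
  qed (use st in auto)
  have "\<Phi> r + \<Phi> (- r) = (\<integral>t. \<bar>r - max (- r) (min r t)\<bar> + \<bar>- r - max (- r) (min r t)\<bar> \<partial>deriv_measure f)"
    unfolding \<Phi>_def by (intro Bochner_Integration.integral_add[symmetric] integrable_truncated_abs)
  also have "\<dots> = (\<integral>t. 2 * r \<partial>deriv_measure f)"
    using assms by (intro Bochner_Integration.integral_cong) (auto simp: max_def min_def)
  also have "\<dots> = 4 * A * r"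
    by (simp add: measure_deriv_measure_UNIV space_deriv_measure)
  finally have "\<Phi> r + \<Phi> (- r) = 4 * A * r" .
  moreover have "\<Phi> (- r) - 2 * f (- r) = \<Phi> x - 2 * f x" "\<Phi> x - 2 * f x = \<Phi> r - 2 * f r"
    using assms by (auto intro!: const)
  ultimately show ?thesis
    unfolding \<Phi>_def[symmetric] by simp
qed

lemma has_bochner_integral_abs_deriv_measure:
  assumes c: "((\<lambda>u. f u - 2 * A * u + f (- u)) \<longlongrightarrow> c) at_top"
  shows "has_bochner_integral (deriv_measure f) (\<lambda>t. \<bar>x - t\<bar>) (2 * f x - c)"
proof (rule has_bochner_integral_monotone_convergence)
  \<comment> \<open>The shift by \<open>\<bar>x\<bar>\<close> keeps \<open>x\<close> inside the truncation interval; only then is the integrand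
    monotone in \<open>n\<close>.\<close>
  define r where "r n = \<bar>x\<bar> + real n" for n
  show "integrable (deriv_measure f) (\<lambda>t. \<bar>x - max (- r n) (min (r n) t)\<bar>)" for n
    by (rule integrable_truncated_abs)
  show "AE t in deriv_measure f. mono (\<lambda>n. \<bar>x - max (- r n) (min (r n) t)\<bar>)"
  proof (intro AE_I2 monoI)
    fix t and m n :: nat assume "m \<le> n"
    then have "\<bar>x\<bar> \<le> r m" "r m \<le> r n" by (auto simp: r_def)
    then show "\<bar>x - max (- r m) (min (r m) t)\<bar> \<le> \<bar>x - max (- r n) (min (r n) t)\<bar>"
      by (auto simp: max_def min_def)
  qed
  show "AE t in deriv_measure f. (\<lambda>n. \<bar>x - max (- r n) (min (r n) t)\<bar>) \<longlonglongrightarrow> \<bar>x - t\<bar>"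
  proof (intro AE_I2 tendsto_eventually)
    fix t
    obtain k where k: "\<bar>t\<bar> \<le> real k" using real_arch_simple by blast
    show "\<forall>\<^sub>F n in sequentially. \<bar>x - max (- r n) (min (r n) t)\<bar> = \<bar>x - t\<bar>"
      using eventually_ge_at_top[of k]
    proof eventually_elim
      case (elim n)
      then have "\<bar>t\<bar> \<le> r n" using k by (simp add: r_def)
      then have "max (- r n) (min (r n) t) = t" by auto
      then show ?case by simp
    qed
  qed
  have "filterlim r at_top sequentially"
    unfolding r_def
    by (intro filterlim_tendsto_add_at_top[OF tendsto_const] filterlim_real_sequentially)
  then have "(\<lambda>n. 2 * f x - (f (r n) - 2 * A * r n + f (- r n))) \<longlonglongrightarrow> 2 * f x - c"
    by (intro tendsto_intros filterlim_compose[OF c])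
  then show "(\<lambda>n. \<integral>t. \<bar>x - max (- r n) (min (r n) t)\<bar> \<partial>deriv_measure f) \<longlonglongrightarrow> 2 * f x - c"
    by (subst integral_truncated_abs) (simp_all add: r_def)
  show "(\<lambda>t. \<bar>x - t\<bar>) \<in> borel_measurable (deriv_measure f)"
    by (simp add: measurable_cong_sets[OF sets_deriv_measure refl])
qed

end

section \<open>The restriction of a norm to a line\<close>

lemma convex_on_norm_line:
  assumes nrm: "is_norm (nrm :: real \<times> real \<Rightarrow> real)"
  shows "convex_on UNIV (\<lambda>u. nrm (u, 1))"
proof (rule convex_onI)
  fix t x y :: real assume t: "0 < t" "t < 1"
  have "((1 - t) *\<^sub>R x + t *\<^sub>R y, 1) = (1 - t) *\<^sub>R (x, 1::real) + t *\<^sub>R (y, 1)"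
    by simp
  also have "nrm \<dots> \<le> nrm ((1 - t) *\<^sub>R (x, 1)) + nrm (t *\<^sub>R (y, 1))"
    using nrm unfolding is_norm_def by blast
  also have "\<dots> = (1 - t) * nrm (x, 1) + t * nrm (y, 1)"
    using nrm t unfolding is_norm_def by (simp del: scaleR_Pair)
  finally show "nrm ((1 - t) *\<^sub>R x + t *\<^sub>R y, 1) \<le> (1 - t) * nrm (x, 1) + t * nrm (y, 1)" .
qed simp

lemma norm_prod_horizontal:
  assumes "is_norm (nrm :: real \<times> real \<Rightarrow> real)"
  shows "nrm (u, 0) = \<bar>u\<bar> * nrm (1, 0)"
proof -
  have "nrm (u *\<^sub>R (1, 0)) = \<bar>u\<bar> * nrm (1, 0)"
    using assms unfolding is_norm_def by blast
  then show ?thesis by simp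
qed

lemma norm_prod_minus:
  assumes "is_norm (nrm :: real \<times> real \<Rightarrow> real)"
  shows "nrm (- u, - v) = nrm (u, v)"
proof -
  have "nrm ((- 1) *\<^sub>R (u, v)) = \<bar>- 1\<bar> * nrm (u, v)"
    using assms unfolding is_norm_def by blast
  then show ?thesis by simp
qed

lemma norm_prod_eq_slice:
  assumes "is_norm (nrm :: real \<times> real \<Rightarrow> real)" "v \<noteq> 0"
  shows "nrm (u, v) = \<bar>v\<bar> * nrm (u / v, 1)"
proof -
  have "nrm (v *\<^sub>R (u / v, 1)) = \<bar>v\<bar> * nrm (u / v, 1)"
    using assms(1) unfolding is_norm_def by blast
  then show ?thesis using assms(2) by simp
qed

lemma norm_line_lipschitz:
  assumes "is_norm (nrm :: real \<times> real \<Rightarrow> real)"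
  shows "nrm (x, v) \<le> nrm (y, v) + \<bar>x - y\<bar> * nrm (1, 0)"
proof -
  have "nrm ((y, v) + (x - y, 0)) \<le> nrm (y, v) + nrm (x - y, 0)"
    using assms unfolding is_norm_def by blast
  then show ?thesis by (simp add: norm_prod_horizontal[OF assms, of "x - y"])
qed

lemma norm_line_lower_bound:
  assumes "is_norm (nrm :: real \<times> real \<Rightarrow> real)"
  shows "\<bar>u\<bar> * nrm (1, 0) - nrm (0, 1) \<le> nrm (u, 1)"
proof -
  have "nrm ((u, 1) + (0, - 1)) \<le> nrm (u, 1) + nrm (0, - 1)"
    using assms unfolding is_norm_def by blast
  then show ?thesis
    using norm_prod_minus[OF assms, of 0 1] norm_prod_horizontal[OF assms, of u] by simp
qed

text \<open>By convexity the derivative at \<open>x\<close> is at least (at most, for \<open>x < 0\<close>) the slope of the chord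
  from \<open>0\<close> to \<open>x\<close>, where the lower bound on the norm costs only \<open>O(1/\<bar>x\<bar>)\<close>.\<close>

lemma right_deriv_norm_line_bounds:
  assumes nrm: "is_norm (nrm :: real \<times> real \<Rightarrow> real)"
  defines "D \<equiv> right_deriv (\<lambda>u. nrm (u, 1))"
  shows "\<bar>D x\<bar> \<le> nrm (1, 0)"
    and "x > 0 \<Longrightarrow> D x \<ge> nrm (1, 0) - 2 * nrm (0, 1) / x"
    and "x < 0 \<Longrightarrow> D x \<le> - nrm (1, 0) - 2 * nrm (0, 1) / x"
proof -
  note cvx = convex_on_norm_line[OF nrm]
  show "\<bar>D x\<bar> \<le> nrm (1, 0)"
    using right_deriv_le_slope[OF cvx, of x "x + 1"] slope_le_right_deriv[OF cvx, of "x - 1" x]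
      norm_line_lipschitz[OF nrm, of "x + 1" 1 x] norm_line_lipschitz[OF nrm, of "x - 1" 1 x]
    by (simp add: D_def)
  show "D x \<ge> nrm (1, 0) - 2 * nrm (0, 1) / x" if "x > 0"
  proof -
    have "nrm (1, 0) - 2 * nrm (0, 1) / x = (\<bar>x\<bar> * nrm (1, 0) - 2 * nrm (0, 1)) / x"
      using that by (simp add: field_simps)
    also have "\<dots> \<le> (nrm (x, 1) - nrm (0, 1)) / (x - 0)"
      using that norm_line_lower_bound[OF nrm, of x] by (simp add: divide_right_mono)
    also have "\<dots> \<le> D x"
      unfolding D_def using slope_le_right_deriv[OF cvx, of 0 x] that by simp
    finally show ?thesis .
  qed
  show "D x \<le> - nrm (1, 0) - 2 * nrm (0, 1) / x" if "x < 0"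
  proof -
    have "D x \<le> (nrm (0, 1) - nrm (x, 1)) / (0 - x)"
      unfolding D_def using right_deriv_le_slope[OF cvx, of x 0] that by simp
    also have "\<dots> \<le> (2 * nrm (0, 1) - \<bar>x\<bar> * nrm (1, 0)) / (0 - x)"
      using that norm_line_lower_bound[OF nrm, of x] by (intro divide_right_mono) auto
    also have "\<dots> = - nrm (1, 0) - 2 * nrm (0, 1) / x"
      using that by (simp add: field_simps)
    finally show ?thesis .
  qed
qed

lemma right_deriv_norm_line_at_top:
  assumes nrm: "is_norm (nrm :: real \<times> real \<Rightarrow> real)"
  shows "(right_deriv (\<lambda>u. nrm (u, 1)) \<longlongrightarrow> nrm (1, 0)) at_top"
proof (rule tendsto_sandwich)
  show "\<forall>\<^sub>F x in at_top. nrm (1, 0) - 2 * nrm (0, 1) / x \<le> right_deriv (\<lambda>u. nrm (u, 1)) x"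
    using eventually_gt_at_top[of 0] by eventually_elim (rule right_deriv_norm_line_bounds[OF nrm])
  show "\<forall>\<^sub>F x in at_top. right_deriv (\<lambda>u. nrm (u, 1)) x \<le> nrm (1, 0)"
    using right_deriv_norm_line_bounds(1)[OF nrm] by (simp add: abs_le_iff)
  have "((\<lambda>x::real. 2 * nrm (0, 1) / x) \<longlongrightarrow> 0) at_top"
    by (rule real_tendsto_divide_at_top[OF tendsto_const filterlim_ident])
  then show "((\<lambda>x. nrm (1, 0) - 2 * nrm (0, 1) / x) \<longlongrightarrow> nrm (1, 0)) at_top"
    using tendsto_diff[OF tendsto_const] by fastforce
qed simp

lemma right_deriv_norm_line_at_bot:
  assumes nrm: "is_norm (nrm :: real \<times> real \<Rightarrow> real)"
  shows "(right_deriv (\<lambda>u. nrm (u, 1)) \<longlongrightarrow> - nrm (1, 0)) at_bot"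
proof (rule tendsto_sandwich)
  show "\<forall>\<^sub>F x in at_bot. right_deriv (\<lambda>u. nrm (u, 1)) x \<le> - nrm (1, 0) - 2 * nrm (0, 1) / x"
    using eventually_gt_at_bot[of 0] by eventually_elim (rule right_deriv_norm_line_bounds[OF nrm])
  show "\<forall>\<^sub>F x in at_bot. - nrm (1, 0) \<le> right_deriv (\<lambda>u. nrm (u, 1)) x"
  proof (rule always_eventually, rule allI)
    fix x show "- nrm (1, 0) \<le> right_deriv (\<lambda>u. nrm (u, 1)) x"
      using right_deriv_norm_line_bounds(1)[OF nrm, of x] by (simp add: abs_le_iff)
  qed
  have "((\<lambda>x::real. 2 * nrm (0, 1) / x) \<longlongrightarrow> 0) at_bot"
    by (rule tendsto_divide_0[OF tendsto_const])
      (simp add: filterlim_at_bot_imp_at_infinity filterlim_ident)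
  then show "((\<lambda>x. - nrm (1, 0) - 2 * nrm (0, 1) / x) \<longlongrightarrow> - nrm (1, 0)) at_bot"
    using tendsto_diff[OF tendsto_const] by fastforce
qed simp

text \<open>Moving from \<open>u\<close> to \<open>w \<ge> u\<close> raises \<open>N(u)\<close> and \<open>N(-u)\<close> by at most \<open>A (w - u)\<close> each, so the
  expression below is nonincreasing; it is bounded below by 0 because \<open>(u, 1) + (u, -1) = (2u, 0)\<close>.\<close>

lemma norm_second_difference_converges:
  assumes nrm: "is_norm (nrm :: real \<times> real \<Rightarrow> real)"
  obtains c where "((\<lambda>u. nrm (u, 1) - 2 * nrm (1, 0) * u + nrm (- u, 1)) \<longlongrightarrow> c) at_top" "c \<ge> 0"
proof -
  define g where "g u = nrm (u, 1) - 2 * nrm (1, 0) * u + nrm (- u, 1)" for u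
  have nonneg: "0 \<le> g u" for u
  proof -
    have "nrm ((u, 1) + (u, - 1)) \<le> nrm (u, 1) + nrm (u, - 1)"
      using nrm unfolding is_norm_def by blast
    then have "\<bar>2 * u\<bar> * nrm (1, 0) \<le> nrm (u, 1) + nrm (- u, 1)"
      using norm_prod_minus[OF nrm, of "- u" 1] norm_prod_horizontal[OF nrm, of "2 * u"] by simp
    moreover have "2 * u * nrm (1, 0) \<le> \<bar>2 * u\<bar> * nrm (1, 0)"
      using nrm unfolding is_norm_def by (intro mult_right_mono) auto
    ultimately show ?thesis by (simp add: g_def mult_ac)
  qed
  have anti: "g w \<le> g u" if "u \<le> w" for u w
    using that norm_line_lipschitz[OF nrm, of w 1 u] norm_line_lipschitz[OF nrm, of "- w" 1 "- u"]
    by (simp add: g_def algebra_simps)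
  have bdd: "bdd_below (range g)"
    using nonneg by (intro bdd_belowI2)
  have "(g \<longlongrightarrow> (INF u. g u)) at_top"
  proof (rule decreasing_tendsto)
    show "\<forall>\<^sub>F u in at_top. (INF u. g u) \<le> g u"
      using cINF_lower[OF bdd] by (intro always_eventually) auto
    fix l assume "(INF u. g u) < l"
    then obtain u where "g u < l"
      using cINF_less_iff[OF _ bdd] by auto
    then show "\<forall>\<^sub>F w in at_top. g w < l"
      using anti by (intro eventually_mono[OF eventually_ge_at_top[of u]]) (rule le_less_trans)
  qed
  moreover have "(INF u. g u) \<ge> 0"
    by (rule cINF_greatest) (auto simp: nonneg)
  ultimately show thesis
    using that unfolding g_def by blast
qed

section \<open>The integral representation of the norm\<close>

theorem theorem1p1:
  fixes nrm :: "real \<times> real \<Rightarrow> real" and N :: "real \<Rightarrow> real"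
  assumes "is_norm nrm"
    and N_def: "\<And>u. N u = nrm (u, 1)"
  shows "convex_on UNIV N \<and>
    (\<exists>c::real. ((\<lambda>u. nrm (u, 1) - 2 * nrm (u, 0) + nrm (u, -1)) \<longlongrightarrow> c) at_top \<and> c \<ge> 0 \<and>
      (\<forall>u v. integrable (deriv_measure N) (\<lambda>t. \<bar>u - t * v\<bar>) \<and>
        nrm (u, v) = c * \<bar>v\<bar> / 2 + 1 / 2 * (\<integral>t. \<bar>u - t * v\<bar> \<partial>deriv_measure N)))"
proof -
  note nrm = \<open>is_norm nrm\<close>
  have N: "N = (\<lambda>u. nrm (u, 1))"
    using N_def by auto
  note cvx = convex_on_norm_line[OF nrm, folded N]
  note top = right_deriv_norm_line_at_top[OF nrm, folded N]
  note bot = right_deriv_norm_line_at_bot[OF nrm, folded N]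
  obtain c where c: "((\<lambda>u. N u - 2 * nrm (1, 0) * u + N (- u)) \<longlongrightarrow> c) at_top" "c \<ge> 0"
    using norm_second_difference_converges[OF nrm] unfolding N by blast
  have "\<forall>\<^sub>F u in at_top. N u - 2 * nrm (1, 0) * u + N (- u) = nrm (u, 1) - 2 * nrm (u, 0) + nrm (u, -1)"
    using eventually_ge_at_top[of 0]
  proof eventually_elim
    case (elim u)
    then show ?case
      using norm_prod_horizontal[OF nrm, of u] norm_prod_minus[OF nrm, of "- u" 1] by (simp add: N)
  qed
  then have lim: "((\<lambda>u. nrm (u, 1) - 2 * nrm (u, 0) + nrm (u, -1)) \<longlongrightarrow> c) at_top"
    using c(1) by (rule Lim_transform_eventually[rotated])
  have repr: "integrable (deriv_measure N) (\<lambda>t. \<bar>u - t * v\<bar>) \<and>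
      nrm (u, v) = c * \<bar>v\<bar> / 2 + 1 / 2 * (\<integral>t. \<bar>u - t * v\<bar> \<partial>deriv_measure N)" for u v
  proof (cases "v = 0")
    case True
    interpret finite_measure "deriv_measure N"
      by (rule finite_measure_deriv_measure[OF cvx top bot])
    show ?thesis
      using True norm_prod_horizontal[OF nrm, of u] space_deriv_measure[OF cvx top bot]
        measure_deriv_measure_UNIV[OF cvx top bot]
      by simp
  next
    case False
    have "has_bochner_integral (deriv_measure N) (\<lambda>t. \<bar>v\<bar> * \<bar>u / v - t\<bar>) (\<bar>v\<bar> * (2 * N (u / v) - c))"
      by (intro has_bochner_integral_mult_right
          has_bochner_integral_abs_deriv_measure[OF cvx top bot c(1)])
    moreover have "\<bar>v\<bar> * \<bar>u / v - t\<bar> = \<bar>u - t * v\<bar>" for t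
      using False by (simp add: abs_mult[symmetric] field_simps)
    ultimately have "has_bochner_integral (deriv_measure N) (\<lambda>t. \<bar>u - t * v\<bar>) (\<bar>v\<bar> * (2 * N (u / v) - c))"
      by simp
    then show ?thesis
      using norm_prod_eq_slice[OF nrm False, of u]
      by (auto simp: has_bochner_integral_iff N algebra_simps)
  qed
  show ?thesis
    using cvx lim c(2) repr by blast
qed

end
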